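(* For every $q\geq 1$, the class $\mathcal{TD}_q$ of graphs of treedepth at most $q$ is homomorphism distinguishing closed.
   Context: Graphs are finite, simple, undirected; $\hom(F,G)$ is the number of homomorphisms from $F$ to $G$. Treedepth of $G$: minimum height (number of vertices on a longest root-to-leaf path) of a rooted forest on $V(G)$ such that every edge of $G$ joins an ancestor–descendant pair. Graphs $G,H$ are homomorphism indistinguishable over a class $\mathcal{F}$, written $G\equiv_{\mathcal{F}}H$, if $\hom(F,G)=\hom(F,H)$ for all $F\in\mathcal{F}$. The homomorphism distinguishing closure of $\mathcal{F}$ is $\mathrm{cl}(\mathcal{F})=\{F \mid \forall G,H:\ G\equiv_{\mathcal{F}}H\Rightarrow \hom(F,G)=\hom(F,H)\}$, and $\mathcal{F}$ is homomorphism distinguishing closed if $\mathrm{cl}(\mathcal{F})=\mathcal{F}$. *)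

theory Defs
  imports "Graph_Theory.Pair_Digraph" "HOL-Library.FuncSet"
begin

text \<open>A finite simple undirected graph is a \<open>pair_graph\<close>: a finite, loop-free, symmetric set of
  arcs, an undirected edge being a pair of opposite arcs. The graph without vertices is included.\<close>

definition homs :: "'a pair_pre_digraph \<Rightarrow> 'b pair_pre_digraph \<Rightarrow> ('a \<Rightarrow> 'b) set" where
  "homs F G = {f \<in> pverts F \<rightarrow>\<^sub>E pverts G. \<forall>(u, v) \<in> parcs F. (f u, f v) \<in> parcs G}"

definition hom :: "'a pair_pre_digraph \<Rightarrow> 'b pair_pre_digraph \<Rightarrow> nat" where
  "hom F G = card (homs F G)"

text \<open>A rooted forest on \<open>V\<close> is given by its relation \<open>R\<close> of (parent, child) pairs: every vertex has
  at most one parent, and the vertices without a parent are the roots. For finite \<open>V\<close>, acyclicity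
  makes every vertex reachable from exactly one root. Proper ancestry is \<open>R\<^sup>+\<close>.\<close>

definition rooted_forest :: "'a set \<Rightarrow> ('a \<times> 'a) set \<Rightarrow> bool" where
  "rooted_forest V R \<longleftrightarrow> R \<subseteq> V \<times> V \<and> acyclic R \<and> single_valued (R\<inverse>)"

definition root_leaf_path :: "'a set \<Rightarrow> ('a \<times> 'a) set \<Rightarrow> 'a list \<Rightarrow> bool" where
  "root_leaf_path V R p \<longleftrightarrow>
     p \<noteq> [] \<and> set p \<subseteq> V \<and> successively (\<lambda>u v. (u, v) \<in> R) p \<and>
     hd p \<notin> Range R \<and> last p \<notin> Domain R"

text \<open>The inserted \<open>0\<close> only matters for the empty forest, which has no path.\<close>

definition forest_height :: "'a set \<Rightarrow> ('a \<times> 'a) set \<Rightarrow> nat" where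
  "forest_height V R = Max (insert 0 (length ` {p. root_leaf_path V R p}))"

definition elimination_forest :: "'a pair_pre_digraph \<Rightarrow> ('a \<times> 'a) set \<Rightarrow> bool" where
  "elimination_forest G R \<longleftrightarrow>
     rooted_forest (pverts G) R \<and> (\<forall>(u, v) \<in> parcs G. (u, v) \<in> R\<^sup>+ \<or> (v, u) \<in> R\<^sup>+)"

definition treedepth :: "'a pair_pre_digraph \<Rightarrow> nat" where
  "treedepth G = (LEAST h. \<exists>R. elimination_forest G R \<and> forest_height (pverts G) R = h)"

text \<open>Classes of graphs are sets of graphs with vertices in \<open>nat\<close>; every finite graph is isomorphic
  to such a graph.\<close>

definition hom_indist ::
    "nat pair_pre_digraph set \<Rightarrow> nat pair_pre_digraph \<Rightarrow> nat pair_pre_digraph \<Rightarrow> bool" where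
  "hom_indist \<F> G H \<longleftrightarrow> (\<forall>F \<in> \<F>. hom F G = hom F H)"

definition hom_dist_closure :: "nat pair_pre_digraph set \<Rightarrow> nat pair_pre_digraph set" where
  "hom_dist_closure \<F> =
     {F. pair_graph F \<and>
         (\<forall>G H. pair_graph G \<longrightarrow> pair_graph H \<longrightarrow> hom_indist \<F> G H \<longrightarrow> hom F G = hom F H)}"

definition hom_dist_closed :: "nat pair_pre_digraph set \<Rightarrow> bool" where
  "hom_dist_closed \<F> \<longleftrightarrow> hom_dist_closure \<F> = \<F>"

definition TD :: "nat \<Rightarrow> nat pair_pre_digraph set" where
  "TD q = {G. pair_graph G \<and> treedepth G \<le> q}"

end

theory Submission
  imports Defs
begin

text \<open>If \<open>F\<close> has treedepth greater than \<open>q\<close>, so has some component \<open>C\<close> of \<open>F\<close>; fix \<open>u \<in> C\<close> and compare the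
  untwisted CFI graph over \<open>F\<close> with the one twisted at \<open>u\<close>. Over a fixed homomorphism \<open>h : T \<rightarrow> F\<close>, the
  homomorphisms from \<open>T\<close> into either graph are the solutions of a linear system over the two-element
  field, homogeneous in the untwisted case. For \<open>h = id\<close> the twisted system has no solution, since the parities over
  \<open>C\<close> add up to an odd number; hence \<open>F\<close> has fewer homomorphisms into the twisted graph. If \<open>T\<close> has treedepth
  at most \<open>q\<close>, the twisted system is always solvable: going down an elimination forest of \<open>T\<close>, the
  parity defect at \<open>u\<close> escapes within \<open>F\<close> like a robber from \<open>q\<close> cops. So \<open>T\<close> does not
  distinguish the two graphs.\<close>

section \<open>Treedepth by vertex elimination\<close>

text \<open>Vertex-elimination form of treedepth: in each round one vertex may be deleted from every
  component. As a predicate on vertex sets it serves both sides of the game: rule induction over the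
  source graph builds the lift, and its failure on subsets of the target leaves room for the robber.
  Rule \<open>insert\<close> also covers \<open>v \<in> A\<close>, which gives monotonicity in
  \<open>k\<close>.\<close>

inductive elim_depth :: "'a rel \<Rightarrow> nat \<Rightarrow> 'a set \<Rightarrow> bool" for E where
  empty: "elim_depth E k {}"
| disjoint_union: "elim_depth E k A \<Longrightarrow> elim_depth E k B \<Longrightarrow> A \<inter> B = {} \<Longrightarrow> E \<inter> (A \<times> B \<union> B \<times> A) = {}
    \<Longrightarrow> elim_depth E k (A \<union> B)"
| insert: "elim_depth E k A \<Longrightarrow> elim_depth E (Suc k) (insert v A)"

lemma elim_depth_card: "finite A \<Longrightarrow> elim_depth E (card A) A"
  by (induction rule: finite_induct) (auto intro: elim_depth.intros)

lemma elim_depth_Suc: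
  assumes "elim_depth E k A" "A \<noteq> {}"
  shows "elim_depth E (Suc k) A"
proof -
  obtain v where "v \<in> A" using assms(2) by blast
  then show ?thesis using elim_depth.insert[OF assms(1), of v] by (simp add: insert_absorb)
qed

lemma elim_depth_UNION:
  assumes "finite I" "\<And>i. i \<in> I \<Longrightarrow> elim_depth E k (A i)"
    and "\<And>i j. i \<in> I \<Longrightarrow> j \<in> I \<Longrightarrow> i \<noteq> j \<Longrightarrow> A i \<inter> A j = {} \<and> E \<inter> A i \<times> A j = {}"
  shows "elim_depth E k (\<Union>i\<in>I. A i)"
  using assms
proof (induction rule: finite_induct)
  case empty
  then show ?case by (simp add: elim_depth.empty)
next
  case (insert i I)
  have "elim_depth E k (\<Union>i\<in>I. A i)" using insert.IH insert.prems by blast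
  moreover have "A i \<inter> A j = {} \<and> E \<inter> A i \<times> A j = {} \<and> E \<inter> A j \<times> A i = {}" if "j \<in> I" for j
    using insert.prems(2)[of i j] insert.prems(2)[of j i] insert.hyps(2) that by blast
  ultimately have "elim_depth E k (A i \<union> (\<Union>i\<in>I. A i))"
    using insert.prems(1)[of i] by (intro elim_depth.disjoint_union) blast+
  then show ?case by simp
qed

text \<open>The depth function \<open>d\<close> replaces both acyclicity and the bound on root-to-leaf paths.\<close>

lemma elim_depth_imp_ranked_forest:
  assumes "elim_depth E k A"
  shows "\<exists>R (d :: 'a \<Rightarrow> nat). R \<subseteq> A \<times> A \<and> single_valued (R\<inverse>) \<and> (\<forall>(u, v) \<in> R. d u < d v) \<and>
    (\<forall>v \<in> A. d v < k) \<and> (\<forall>u \<in> A. \<forall>v \<in> A. (u, v) \<in> E \<longrightarrow> u = v \<or> (u, v) \<in> R\<^sup>+ \<or> (v, u) \<in> R\<^sup>+)"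
  using assms
proof (induction rule: elim_depth.induct)
  case (empty k)
  show ?case by (rule exI[of _ "{}"]) auto
next
  case (disjoint_union k A B)
  obtain R1 d1 where 1: "R1 \<subseteq> A \<times> A" "single_valued (R1\<inverse>)" "\<forall>(u, v) \<in> R1. d1 u < (d1 v :: nat)"
    "\<forall>v \<in> A. d1 v < k" "\<forall>u \<in> A. \<forall>v \<in> A. (u, v) \<in> E \<longrightarrow> u = v \<or> (u, v) \<in> R1\<^sup>+ \<or> (v, u) \<in> R1\<^sup>+"
    using disjoint_union.IH(1) by blast
  obtain R2 d2 where 2: "R2 \<subseteq> B \<times> B" "single_valued (R2\<inverse>)" "\<forall>(u, v) \<in> R2. d2 u < (d2 v :: nat)"
    "\<forall>v \<in> B. d2 v < k" "\<forall>u \<in> B. \<forall>v \<in> B. (u, v) \<in> E \<longrightarrow> u = v \<or> (u, v) \<in> R2\<^sup>+ \<or> (v, u) \<in> R2\<^sup>+"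
    using disjoint_union.IH(2) by blast
  let ?d = "\<lambda>v. if v \<in> A then d1 v else d2 v"
  have sub: "R1\<^sup>+ \<subseteq> (R1 \<union> R2)\<^sup>+" "R2\<^sup>+ \<subseteq> (R1 \<union> R2)\<^sup>+" by (simp_all add: trancl_mono_subset)
  have "single_valued ((R1 \<union> R2)\<inverse>)"
    using 1(1,2) 2(1,2) disjoint_union.hyps(3) unfolding single_valued_def by blast
  moreover have "\<forall>(u, v) \<in> R1 \<union> R2. ?d u < ?d v"
    using 1(1,3) 2(1,3) disjoint_union.hyps(3) by fastforce
  moreover have "\<forall>v \<in> A \<union> B. ?d v < k" using 1(4) 2(4) by auto
  moreover have "\<forall>u \<in> A \<union> B. \<forall>v \<in> A \<union> B. (u, v) \<in> E \<longrightarrow>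
      u = v \<or> (u, v) \<in> (R1 \<union> R2)\<^sup>+ \<or> (v, u) \<in> (R1 \<union> R2)\<^sup>+"
    using 1(5) 2(5) disjoint_union.hyps(4) sub by blast
  moreover have "R1 \<union> R2 \<subseteq> (A \<union> B) \<times> (A \<union> B)" using 1(1) 2(1) by blast
  ultimately show ?case by (intro exI[of _ "R1 \<union> R2"] exI[of _ ?d] conjI)
next
  case (insert k A v)
  obtain R d where R: "R \<subseteq> A \<times> A" "single_valued (R\<inverse>)" "\<forall>(u, v) \<in> R. d u < (d v :: nat)"
    "\<forall>v \<in> A. d v < k" "\<forall>u \<in> A. \<forall>v \<in> A. (u, v) \<in> E \<longrightarrow> u = v \<or> (u, v) \<in> R\<^sup>+ \<or> (v, u) \<in> R\<^sup>+"
    using insert.IH by blast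
  show ?case
  proof (cases "v \<in> A")
    case True
    then have "insert v A = A" by blast
    then show ?thesis using R less_SucI by metis
  next
    case False
    \<comment> \<open>The new vertex becomes the parent of all old roots, and every old depth shifts
      by one.\<close>
    define R' where "R' = R \<union> {v} \<times> (A - Range R)"
    let ?d = "\<lambda>u. if u = v then 0 else Suc (d u)"
    \<comment> \<open>Climbing from \<open>a\<close> to its parents lowers \<open>d\<close>, so a
      root of \<open>R\<close>, and hence \<open>v\<close>, is reached.\<close>
    have reach: "(v, a) \<in> R'\<^sup>+" if "a \<in> A" for a
      using that
    proof (induction "d a" arbitrary: a rule: less_induct)
      case less
      show ?case
      proof (cases "a \<in> Range R")
        case True
        then obtain b where b: "(b, a) \<in> R" by blast
        then have "(v, b) \<in> R'\<^sup>+" using less R(1,3) by blast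
        then show ?thesis using b unfolding R'_def by (meson UnI1 trancl.trancl_into_trancl)
      next
        case False
        then show ?thesis using less.prems unfolding R'_def by blast
      qed
    qed
    have "R' \<subseteq> insert v A \<times> insert v A" using R(1) unfolding R'_def by blast
    moreover have "single_valued (R'\<inverse>)"
      using R(1,2) False unfolding R'_def single_valued_def by blast
    moreover have "\<forall>(u, w) \<in> R'. ?d u < ?d w"
      using R(1,3) False unfolding R'_def by auto
    moreover have "\<forall>u \<in> insert v A. ?d u < Suc k" using R(4) by auto
    moreover have "R\<^sup>+ \<subseteq> R'\<^sup>+" unfolding R'_def by (simp add: trancl_mono_subset)
    then have "\<forall>u \<in> insert v A. \<forall>w \<in> insert v A. (u, w) \<in> E \<longrightarrow>
        u = w \<or> (u, w) \<in> R'\<^sup>+ \<or> (w, u) \<in> R'\<^sup>+"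
      using R(5) reach by blast
    ultimately show ?thesis by (intro exI[of _ R'] exI[of _ ?d] conjI)
  qed
qed

section \<open>Elimination yields forests of bounded height\<close>

lemma ranked_path_length:
  fixes d :: "'a \<Rightarrow> nat"
  assumes "\<forall>(u, v) \<in> R. d u < d v" "successively (\<lambda>u v. (u, v) \<in> R) p" "p \<noteq> []"
  shows "length p \<le> Suc (d (last p))"
  using assms(2,3)
proof (induction p rule: rev_induct)
  case (snoc v p)
  then show ?case using assms(1)
    by (cases "p = []") (fastforce simp: successively_append_iff)+
qed simp

text \<open>The ranked forest has depths below \<open>k\<close>, and ranks strictly increase along
  paths. The second claim ensures that the \<open>LEAST\<close> in \<open>treedepth\<close> ranges
  over a nonempty set, as the converse direction requires.\<close>

lemma treedepth_le_if_elim_depth: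
  assumes "pair_graph G" "elim_depth (parcs G) k (pverts G)"
  shows "treedepth G \<le> k" and "\<exists>R. elimination_forest G R"
proof -
  interpret pair_graph G by fact
  obtain R d where R: "R \<subseteq> pverts G \<times> pverts G" "single_valued (R\<inverse>)"
    "\<forall>(u, v) \<in> R. d u < (d v :: nat)" "\<forall>v \<in> pverts G. d v < k"
    "\<forall>u \<in> pverts G. \<forall>v \<in> pverts G. (u, v) \<in> parcs G \<longrightarrow> u = v \<or> (u, v) \<in> R\<^sup>+ \<or> (v, u) \<in> R\<^sup>+"
    using elim_depth_imp_ranked_forest[OF assms(2)] by blast
  have "acyclic R" using R(3) by (intro acyclicI_order[where f = "\<lambda>v. - int (d v)"]) auto
  moreover have "\<forall>(u, v) \<in> parcs G. (u, v) \<in> R\<^sup>+ \<or> (v, u) \<in> R\<^sup>+"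
  proof clarify
    fix u v assume uv: "(u, v) \<in> parcs G" "(v, u) \<notin> R\<^sup>+"
    then have "u \<noteq> v" using pair_no_loops[OF uv(1)] by simp
    then show "(u, v) \<in> R\<^sup>+" using R(5) uv wellformed'[OF uv(1)] by blast
  qed
  ultimately have ef: "elimination_forest G R"
    unfolding elimination_forest_def rooted_forest_def
    using R(1,2) by blast
  have "length p \<le> k" if "root_leaf_path (pverts G) R p" for p
  proof -
    have p: "p \<noteq> []" "set p \<subseteq> pverts G" "successively (\<lambda>u v. (u, v) \<in> R) p"
      using that unfolding root_leaf_path_def by auto
    then have "d (last p) < k" using R(4) by (meson last_in_set subsetD)
    then show ?thesis using ranked_path_length[OF R(3) p(3,1)] by linarith
  qed
  \<comment> \<open>\<open>Max\<close> is meaningful only for a finite set; the bound on the lengths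
    supplies finiteness.\<close>
  then have sub: "length ` {p. root_leaf_path (pverts G) R p} \<subseteq> {..k}" by auto
  then have "finite (length ` {p. root_leaf_path (pverts G) R p})" using finite_subset by blast
  then have "forest_height (pverts G) R \<le> k" unfolding forest_height_def using sub by auto
  moreover have "treedepth G \<le> forest_height (pverts G) R"
    unfolding treedepth_def using ef by (intro Least_le) blast
  ultimately show "treedepth G \<le> k" by linarith
  show "\<exists>R. elimination_forest G R" using ef by blast
qed

section \<open>Forests of bounded height yield eliminations\<close>

lemma path_in_trancl:
  assumes "successively (\<lambda>u v. (u, v) \<in> R) (u # p)" "v \<in> set p"
  shows "(u, v) \<in> R\<^sup>+"
  using assms
proof (induction p arbitrary: u)
  case (Cons w p)
  then show ?case by (auto intro: trancl_into_trancl2)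
qed simp

lemma acyclic_path_distinct:
  assumes "acyclic R" "successively (\<lambda>u v. (u, v) \<in> R) p"
  shows "distinct p"
  using assms(2)
proof (induction p)
  case (Cons u p)
  then have "distinct p" by (auto simp: successively_Cons)
  moreover have "u \<notin> set p" using path_in_trancl[OF Cons.prems] assms(1) by (auto simp: acyclic_def)
  ultimately show ?case by simp
qed simp

text \<open>Descending from parent to child terminates, because the converse of a finite acyclic
  relation is well-founded. The last conjunct later places the path inside the vertex set.\<close>

lemma ex_path_to_leaf:
  assumes "finite R" "acyclic R"
  shows "\<exists>p. successively (\<lambda>u v. (u, v) \<in> R) (v # p) \<and> last (v # p) \<notin> Domain R \<and> set p \<subseteq> Range R"
  using finite_acyclic_wf_converse[OF assms]
proof (induction v rule: wf_induct_rule)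
  case (less v)
  show ?case
  proof (cases "v \<in> Domain R")
    case True
    then obtain w where w: "(v, w) \<in> R" by blast
    then obtain p where "successively (\<lambda>u v. (u, v) \<in> R) (w # p)" "last (w # p) \<notin> Domain R"
      "set p \<subseteq> Range R" using less by blast
    then show ?thesis using w by (intro exI[of _ "w # p"]) auto
  qed (auto intro: exI[of _ "[]"])
qed

text \<open>Induction on \<open>k\<close> over antichains \<open>I\<close> of the forest order. The
  subtrees below distinct members of \<open>I\<close> are disjoint and not joined by
  \<open>E\<close>. Within one subtree the root is deleted; its children form an antichain again,
  and their paths to leaves are one vertex shorter.\<close>

lemma elim_depth_if_forest_paths:
  assumes R: "finite R" "acyclic R" "single_valued (R\<inverse>)"
    and E: "\<forall>u v. (u, v) \<in> E \<longrightarrow> (u, v) \<in> R\<^sup>+ \<or> (v, u) \<in> R\<^sup>+"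
    and "finite I" "\<forall>i \<in> I. \<forall>j \<in> I. i \<noteq> j \<longrightarrow> (i, j) \<notin> R\<^sup>*"
    and "\<And>i p. i \<in> I \<Longrightarrow> successively (\<lambda>u v. (u, v) \<in> R) (i # p) \<Longrightarrow> last (i # p) \<notin> Domain R
      \<Longrightarrow> set p \<subseteq> Range R \<Longrightarrow> length (i # p) \<le> k"
  shows "elim_depth E k (R\<^sup>* `` I)"
  using assms(5-)
proof (induction k arbitrary: I)
  case 0
  \<comment> \<open>A member of \<open>I\<close> would start a path with at least one vertex,
    against the bound 0.\<close>
  have "I = {}" using ex_path_to_leaf[OF R(1,2)] 0(3) by fastforce
  then show ?case by (simp add: elim_depth.empty)
next
  case (Suc k)
  have "elim_depth E (Suc k) (R\<^sup>* `` {i})" if i: "i \<in> I" for i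
  proof -
    have "elim_depth E k (R\<^sup>* `` (R `` {i}))"
    proof (rule Suc.IH)
      show "finite (R `` {i})" using R(1) by (rule finite_Image)
      show "\<forall>c \<in> R `` {i}. \<forall>c' \<in> R `` {i}. c \<noteq> c' \<longrightarrow> (c, c') \<notin> R\<^sup>*"
      \<comment> \<open>If one child of \<open>i\<close> were a proper ancestor of another, the path
        between them would pass through the unique parent \<open>i\<close> of the latter, closing a
        cycle.\<close>
      proof (intro ballI impI notI)
        fix c c' assume c: "c \<in> R `` {i}" "c' \<in> R `` {i}" "c \<noteq> c'" "(c, c') \<in> R\<^sup>*"
        then obtain b where "(c, b) \<in> R\<^sup>*" "(b, c') \<in> R" by (meson rtranclE)
        then have "(c, i) \<in> R\<^sup>*" using c(2) R(3) by (metis Image_singleton_iff converse.intros single_valuedD)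
        then have "(i, i) \<in> R\<^sup>+" using c(1) by (meson Image_singleton_iff rtrancl_into_trancl2)
        then show False using R(2) by (simp add: acyclic_def)
      qed
      show "length (c # p) \<le> k" if "c \<in> R `` {i}" "successively (\<lambda>u v. (u, v) \<in> R) (c # p)"
        "last (c # p) \<notin> Domain R" "set p \<subseteq> Range R" for c p
        using Suc.prems(3)[OF i, of "c # p"] that by auto
    qed
    then have "elim_depth E (Suc k) (insert i (R\<^sup>* `` (R `` {i})))" by (rule elim_depth.insert)
    moreover have "insert i (R\<^sup>* `` (R `` {i})) = R\<^sup>* `` {i}"
      by (auto intro: converse_rtrancl_into_rtrancl elim: converse_rtranclE)
    ultimately show ?thesis by simp
  qed
  moreover have "R\<^sup>* `` {i} \<inter> R\<^sup>* `` {j} = {} \<and> E \<inter> R\<^sup>* `` {i} \<times> R\<^sup>* `` {j} = {}"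
    if ij: "i \<in> I" "j \<in> I" "i \<noteq> j" for i j
  proof -
    \<comment> \<open>The ancestors of a vertex form a chain, since parents are unique; a common
      descendant would make \<open>i\<close> and \<open>j\<close> comparable.\<close>
    have sep: "\<not> ((i, c) \<in> R\<^sup>* \<and> (j, c) \<in> R\<^sup>*)" for c
      using single_valued_confluent[OF R(3), of c i j] ij Suc.prems(2)
      by (simp add: rtrancl_converse) blast
    have "(u, v) \<notin> E" if "(i, u) \<in> R\<^sup>*" "(j, v) \<in> R\<^sup>*" for u v
      using E sep that by (meson rtrancl_trans trancl_into_rtrancl)
    then show ?thesis using sep by blast
  qed
  ultimately have "elim_depth E (Suc k) (\<Union>i\<in>I. R\<^sup>* `` {i})"
    using Suc.prems(1) by (intro elim_depth_UNION) auto
  then show ?case by (simp only: Image_eq_UN[symmetric])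
qed

text \<open>An optimal elimination forest is eliminated from its roots downwards: the roots form an
  antichain, and their subtrees cover the graph.\<close>

lemma elim_depth_if_treedepth_le:
  assumes "pair_graph G" "treedepth G \<le> k"
  shows "elim_depth (parcs G) k (pverts G)"
proof -
  interpret pair_graph G by fact
  have "\<exists>R. elimination_forest G R"
    using assms(1) treedepth_le_if_elim_depth(2) elim_depth_card[OF pair_finite_verts] by blast
  then have "\<exists>h R. elimination_forest G R \<and> forest_height (pverts G) R = h" by blast
  then have "\<exists>R. elimination_forest G R \<and> forest_height (pverts G) R = treedepth G"
    unfolding treedepth_def by (rule LeastI_ex)
  then obtain R where R: "elimination_forest G R" "forest_height (pverts G) R \<le> k"
    using assms(2) by auto
  then have f: "R \<subseteq> pverts G \<times> pverts G" "acyclic R" "single_valued (R\<inverse>)"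
    "\<forall>u v. (u, v) \<in> parcs G \<longrightarrow> (u, v) \<in> R\<^sup>+ \<or> (v, u) \<in> R\<^sup>+"
    unfolding elimination_forest_def rooted_forest_def by auto
  have finR: "finite R" using f(1) pair_finite_verts finite_subset by blast
  \<comment> \<open>Paths in an acyclic relation repeat no vertex, so the lengths form a finite set
    and \<open>Max\<close> bounds each of them.\<close>
  have "length p \<le> card (pverts G)" if "root_leaf_path (pverts G) R p" for p
    using that acyclic_path_distinct[OF f(2)] pair_finite_verts unfolding root_leaf_path_def
    by (metis card_mono distinct_card)
  then have "length ` {p. root_leaf_path (pverts G) R p} \<subseteq> {..card (pverts G)}" by auto
  then have "finite (length ` {p. root_leaf_path (pverts G) R p})" using finite_subset by blast
  then have len: "length p \<le> k" if "root_leaf_path (pverts G) R p" for p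
    using R(2) that unfolding forest_height_def by auto
  have "elim_depth (parcs G) k (R\<^sup>* `` (pverts G - Range R))"
  proof (rule elim_depth_if_forest_paths[OF finR f(2,3,4)])
    show "finite (pverts G - Range R)" using pair_finite_verts by blast
    show "\<forall>i \<in> pverts G - Range R. \<forall>j \<in> pverts G - Range R. i \<noteq> j \<longrightarrow> (i, j) \<notin> R\<^sup>*"
      by (metis DiffD2 Range.intros rtranclE)
    show "length (i # p) \<le> k" if "i \<in> pverts G - Range R" "successively (\<lambda>u v. (u, v) \<in> R) (i # p)"
        "last (i # p) \<notin> Domain R" "set p \<subseteq> Range R" for i p
      using that f(1) by (intro len) (auto simp: root_leaf_path_def)
  qed
  moreover have "R\<^sup>* `` (pverts G - Range R) = pverts G"
  proof
    show "R\<^sup>* `` (pverts G - Range R) \<subseteq> pverts G"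
      using f(1) by (auto elim: rtranclE)
    have "\<exists>r \<in> pverts G - Range R. (r, v) \<in> R\<^sup>*" if "v \<in> pverts G" for v
      using finite_acyclic_wf[OF finR f(2)] that
    proof (induction v rule: wf_induct_rule)
      case (less v)
      show ?case
      proof (cases "v \<in> Range R")
        case True
        then obtain w where w: "(w, v) \<in> R" by blast
        then obtain r where "r \<in> pverts G - Range R" "(r, w) \<in> R\<^sup>*" using less f(1) by blast
        then show ?thesis using w by (meson rtrancl.rtrancl_into_rtrancl)
      qed (use less in auto)
    qed
    then show "pverts G \<subseteq> R\<^sup>* `` (pverts G - Range R)" by blast
  qed
  ultimately show ?thesis by simp
qed

lemma treedepth_le_iff_elim_depth:
  assumes "pair_graph G"
  shows "treedepth G \<le> k \<longleftrightarrow> elim_depth (parcs G) k (pverts G)"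
  using assms elim_depth_if_treedepth_le treedepth_le_if_elim_depth(1) by blast

section \<open>Components that are too deep\<close>

text \<open>If \<open>D\<close> is disconnected, split off the part reachable from some vertex. Were
  both parts of depth \<open>k\<close>, so would be their disjoint union; hence one part is too deep
  and the argument repeats there. Connectedness lets the robber move within \<open>C\<close>; the
  absence of arcs leaving \<open>C\<close> is for the parity count in
  \<open>no_cfi_lift_id\<close>.\<close>

lemma ex_component_not_elim_depth:
  assumes "finite D" "sym E" "\<not> elim_depth E k D"
  shows "\<exists>C \<subseteq> D. \<not> elim_depth E k C \<and> (\<forall>a \<in> C. \<forall>b \<in> C. (a, b) \<in> (E \<inter> C \<times> C)\<^sup>*) \<and> E \<inter> C \<times> (D - C) = {}"
  using assms(1,3)
proof (induction D rule: finite_psubset_induct)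
  case (psubset D)
  show ?case
  proof (cases "\<forall>a \<in> D. \<forall>b \<in> D. (a, b) \<in> (E \<inter> D \<times> D)\<^sup>*")
    case True
    then show ?thesis using psubset.prems by (intro exI[of _ D]) auto
  next
    case False
    then obtain a b where ab: "a \<in> D" "b \<in> D" "(a, b) \<notin> (E \<inter> D \<times> D)\<^sup>*" by blast
    define A where "A = {w \<in> D. (a, w) \<in> (E \<inter> D \<times> D)\<^sup>*}"
    have "(v, w) \<notin> E" if "v \<in> A" "w \<in> D - A" for v w
    proof
      assume "(v, w) \<in> E"
      then have "(v, w) \<in> E \<inter> D \<times> D" using that unfolding A_def by blast
      then show False using that unfolding A_def by (auto intro: rtrancl_into_rtrancl)
    qed
    then have noE: "E \<inter> (A \<times> (D - A) \<union> (D - A) \<times> A) = {}" using assms(2) by (auto dest: symD)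
    have AD: "A \<union> (D - A) = D" "A \<subset> D" "D - A \<subset> D" using ab unfolding A_def by auto
    have "\<not> elim_depth E k A \<or> \<not> elim_depth E k (D - A)"
      using psubset.prems elim_depth.disjoint_union[of E k A "D - A"] noE AD(1) by auto
    then obtain B where B: "B \<subset> D" "\<not> elim_depth E k B" "E \<inter> B \<times> (D - B) = {}"
      using AD noE by (metis Diff_Diff_Int Int_Un_distrib Un_empty inf.absorb_iff2 psubset_imp_subset)
    obtain C where "C \<subseteq> B" "\<not> elim_depth E k C" "\<forall>a \<in> C. \<forall>b \<in> C. (a, b) \<in> (E \<inter> C \<times> C)\<^sup>*"
      "E \<inter> C \<times> (B - C) = {}" using psubset.IH[OF B(1,2)] by blast
    then show ?thesis using B by (intro exI[of _ C]) blast
  qed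
qed

section \<open>Routing a parity defect\<close>

lemma odd_card_sym_diff:
  assumes "finite A" "finite B"
  shows "odd (card (sym_diff A B)) \<longleftrightarrow> odd (card A) \<noteq> odd (card B)"
proof -
  have "card (sym_diff A B) = card (A - B) + card (B - A)"
    using assms by (intro card_Un_disjoint) auto
  moreover have "card A = card (A - B) + card (A \<inter> B)" "card B = card (B - A) + card (A \<inter> B)"
    using assms by (metis add.commute card_Diff_subset_Int card_mono finite_Int inf_le1 le_add_diff_inverse
        inf_commute)+
  ultimately show ?thesis by auto
qed

text \<open>Toggling the edges of a walk from \<open>a\<close> to \<open>b\<close> changes the
  degree parity only at its two ends, and not at all if they coincide. A symmetric set of arcs
  stands for a set of edges, and the inequality of truth values is exclusive or.\<close>

lemma move_parity_defect:
  assumes E: "finite E" "sym E" "irrefl E" and x: "sym x" "x \<subseteq> E"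
    and path: "(a, b) \<in> (E \<inter> D \<times> D)\<^sup>*"
  shows "\<exists>x'. sym x' \<and> x' \<subseteq> E \<and> x' - D \<times> D = x - D \<times> D \<and>
    (\<forall>v. odd (card (x' `` {v})) \<longleftrightarrow> odd (card (x `` {v})) \<noteq> ((v = a) \<noteq> (v = b)))"
  using path
proof (induction rule: rtrancl_induct)
  case base
  show ?case using x by (intro exI[of _ x]) simp
next
  case (step b c)
  obtain x' where x': "sym x'" "x' \<subseteq> E" "x' - D \<times> D = x - D \<times> D"
    "\<forall>v. odd (card (x' `` {v})) \<longleftrightarrow> odd (card (x `` {v})) \<noteq> ((v = a) \<noteq> (v = b))"
    using step.IH by blast
  \<comment> \<open>Toggling the last edge of the walk flips the parity at \<open>b\<close> and
    \<open>c\<close>, which moves the free end from \<open>b\<close> to \<open>c\<close>.\<close>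
  let ?e = "{(b, c), (c, b)}"
  let ?x = "sym_diff x' ?e"
  have bc: "b \<noteq> c" "(b, c) \<in> E" "(c, b) \<in> E" "b \<in> D" "c \<in> D"
    using step.hyps(2) E(2,3) by (auto simp: irrefl_def dest: symD)
  have fin: "finite (x' `` {v})" for v using E(1) x'(2) finite_Image finite_subset by metis
  have "?x `` {v} = sym_diff (x' `` {v}) (?e `` {v})" for v by blast
  then have "odd (card (?x `` {v})) \<longleftrightarrow> odd (card (x' `` {v})) \<noteq> odd (card (?e `` {v}))" for v
    using odd_card_sym_diff[OF fin, of "?e `` {v}"] by simp
  moreover have "odd (card (?e `` {v})) \<longleftrightarrow> (v = b) \<noteq> (v = c)" for v
  proof -
    have "?e `` {v} = (if v = b then {c} else if v = c then {b} else {})" using bc(1) by auto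
    then show ?thesis using bc(1) by simp
  qed
  ultimately have "\<forall>v. odd (card (?x `` {v})) \<longleftrightarrow> odd (card (x `` {v})) \<noteq> ((v = a) \<noteq> (v = c))"
    using x'(4) by auto
  moreover have "sym ?x" using x'(1) unfolding sym_def by blast
  moreover have "?x \<subseteq> E" using x'(2) bc by blast
  moreover have "?x - D \<times> D = x - D \<times> D" using x'(3) bc by blast
  ultimately show ?case by (intro exI[of _ ?x] conjI)
qed

text \<open>The defect \<open>e\<close> plays the robber in a cops-and-robber game on \<open>D\<close>: whenever the elimination of \<open>A\<close>
  reaches a vertex \<open>v\<close> with \<open>h v \<in> D\<close>, it retreats to a component of \<open>D - {h v}\<close> that is still too deep.
  The last conjunct of the conclusion (\<open>y\<close> agrees with \<open>x\<close> off \<open>D \<times> D\<close>) keeps the choices made for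
  different branches of the elimination forest consistent with their common ancestors.\<close>

lemma ex_local_parities:
  assumes E: "finite E" "sym E" "irrefl E" and E': "sym E'"
    and depth: "elim_depth E' k A"
    and D: "finite D" "\<not> elim_depth E k D" "\<forall>a \<in> D. \<forall>b \<in> D. (a, b) \<in> (E \<inter> D \<times> D)\<^sup>*" "e \<in> D"
    and x: "sym x" "x \<subseteq> E" "\<forall>v. odd (card (x `` {v})) \<longleftrightarrow> (v \<in> U) \<noteq> (v = e)"
  shows "\<exists>y. (\<forall>a \<in> A. y a \<subseteq> E `` {h a} \<and> (odd (card (y a)) \<longleftrightarrow> h a \<in> U)) \<and>
    (\<forall>a \<in> A. \<forall>b \<in> A. (a, b) \<in> E' \<longrightarrow> (h b \<in> y a \<longleftrightarrow> h a \<in> y b)) \<and>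
    (\<forall>a \<in> A. \<forall>w. (h a, w) \<notin> D \<times> D \<longrightarrow> (w \<in> y a \<longleftrightarrow> (h a, w) \<in> x))"
  using depth D x
proof (induction arbitrary: D e x rule: elim_depth.induct)
  case (empty k)
  show ?case by simp
next
  case (disjoint_union k A B)
  obtain y where y: "\<forall>a \<in> A. y a \<subseteq> E `` {h a} \<and> (odd (card (y a)) \<longleftrightarrow> h a \<in> U)"
    "\<forall>a \<in> A. \<forall>b \<in> A. (a, b) \<in> E' \<longrightarrow> (h b \<in> y a \<longleftrightarrow> h a \<in> y b)"
    "\<forall>a \<in> A. \<forall>w. (h a, w) \<notin> D \<times> D \<longrightarrow> (w \<in> y a \<longleftrightarrow> (h a, w) \<in> x)"
    using disjoint_union.IH(1)[OF disjoint_union.prems] by (elim exE conjE)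
  obtain z where z: "\<forall>a \<in> B. z a \<subseteq> E `` {h a} \<and> (odd (card (z a)) \<longleftrightarrow> h a \<in> U)"
    "\<forall>a \<in> B. \<forall>b \<in> B. (a, b) \<in> E' \<longrightarrow> (h b \<in> z a \<longleftrightarrow> h a \<in> z b)"
    "\<forall>a \<in> B. \<forall>w. (h a, w) \<notin> D \<times> D \<longrightarrow> (w \<in> z a \<longleftrightarrow> (h a, w) \<in> x)"
    using disjoint_union.IH(2)[OF disjoint_union.prems] by (elim exE conjE)
  \<comment> \<open>No arc of \<open>E'\<close> joins \<open>A\<close> and \<open>B\<close>, so the
    two solutions can be glued.\<close>
  let ?y = "\<lambda>a. if a \<in> A then y a else z a"
  have "\<forall>a \<in> A \<union> B. ?y a \<subseteq> E `` {h a} \<and> (odd (card (?y a)) \<longleftrightarrow> h a \<in> U)"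
    using y(1) z(1) by auto
  moreover have "\<forall>a \<in> A \<union> B. \<forall>b \<in> A \<union> B. (a, b) \<in> E' \<longrightarrow> (h b \<in> ?y a \<longleftrightarrow> h a \<in> ?y b)"
    using y(2) z(2) disjoint_union.hyps(3,4) by auto
  moreover have "\<forall>a \<in> A \<union> B. \<forall>w. (h a, w) \<notin> D \<times> D \<longrightarrow> (w \<in> ?y a \<longleftrightarrow> (h a, w) \<in> x)"
    using y(3) z(3) by auto
  ultimately show ?case by (intro exI[of _ ?y] conjI)
next
  case (insert k A v)
  note prems = insert.prems
  have "\<not> elim_depth E k D" using elim_depth_Suc[of E k D] prems(2,4) by blast
  show ?case
  proof (cases "v \<in> A")
    case True
    then have "insert v A = A" by blast
    then show ?thesis
      using insert.IH[OF prems(1) \<open>\<not> elim_depth E k D\<close> prems(3-)] by simp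
  next
    case False
    \<comment> \<open>The next territory \<open>D'\<close> avoids \<open>h v\<close> and is too deep
      for the \<open>k\<close> remaining rounds; \<open>x'\<close> is \<open>x\<close> with the
      defect moved to \<open>e'\<close>, altered only inside \<open>D \<times> D\<close>.\<close>
    obtain D' e' x' where D': "D' \<subseteq> D - {h v}" "\<not> elim_depth E k D'"
      "\<forall>a \<in> D'. \<forall>b \<in> D'. (a, b) \<in> (E \<inter> D' \<times> D')\<^sup>*" "e' \<in> D'"
      and x': "sym x'" "x' \<subseteq> E" "x' - D \<times> D = x - D \<times> D"
        "\<forall>v. odd (card (x' `` {v})) \<longleftrightarrow> (v \<in> U) \<noteq> (v = e')"
    proof (cases "h v \<in> D")
      case True
      \<comment> \<open>Otherwise putting \<open>h v\<close> back would eliminate \<open>D\<close>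
        in \<open>Suc k\<close> rounds.\<close>
      then have "\<not> elim_depth E k (D - {h v})"
        using prems(2) elim_depth.insert[of E k "D - {h v}" "h v"] by (auto simp: insert_absorb)
      then obtain D' where D': "D' \<subseteq> D - {h v}" "\<not> elim_depth E k D'"
          "\<forall>a \<in> D'. \<forall>b \<in> D'. (a, b) \<in> (E \<inter> D' \<times> D')\<^sup>*"
        using ex_component_not_elim_depth[of "D - {h v}" E k] prems(1) E(2) by auto
      then obtain e' where e': "e' \<in> D'" by (metis elim_depth.empty ex_in_conv)
      then have "(e, e') \<in> (E \<inter> D \<times> D)\<^sup>*" using D'(1) prems(3,4) by blast
      from move_parity_defect[OF E prems(5,6) this] obtain x' where
        x': "sym x'" "x' \<subseteq> E" "x' - D \<times> D = x - D \<times> D"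
        "\<forall>v. odd (card (x' `` {v})) \<longleftrightarrow> odd (card (x `` {v})) \<noteq> ((v = e) \<noteq> (v = e'))"
        by (elim exE conjE)
      have "\<forall>v. odd (card (x' `` {v})) \<longleftrightarrow> (v \<in> U) \<noteq> (v = e')"
        using x'(4) prems(7) by auto
      then show ?thesis using that[of D' e' x'] D' e' x' by blast
    next
      case False
      then show ?thesis
        using that[of D e x] prems \<open>\<not> elim_depth E k D\<close> by auto
    qed
    have "finite D'" using D'(1) prems(1) finite_subset by blast
    from insert.IH[OF this D'(2-4) x'(1,2,4)] obtain y where
      y: "\<forall>a \<in> A. y a \<subseteq> E `` {h a} \<and> (odd (card (y a)) \<longleftrightarrow> h a \<in> U)"
      "\<forall>a \<in> A. \<forall>b \<in> A. (a, b) \<in> E' \<longrightarrow> (h b \<in> y a \<longleftrightarrow> h a \<in> y b)"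
      "\<forall>a \<in> A. \<forall>w. (h a, w) \<notin> D' \<times> D' \<longrightarrow> (w \<in> y a \<longleftrightarrow> (h a, w) \<in> x')"
      by (elim exE conjE)
    \<comment> \<open>The choice at \<open>v\<close> is read off \<open>x'\<close>; its parity is
      right because the defect \<open>e'\<close> sits in \<open>D'\<close> and hence away from
      \<open>h v\<close>.\<close>
    let ?y = "y(v := x' `` {h v})"
    have hv: "h v \<notin> D'" "h v \<noteq> e'" using D' by auto
    have "\<forall>a \<in> insert v A. ?y a \<subseteq> E `` {h a} \<and> (odd (card (?y a)) \<longleftrightarrow> h a \<in> U)"
      using y(1) x'(2,4) hv(2) by auto
    \<comment> \<open>Arcs at \<open>h v\<close> lie outside \<open>D' \<times> D'\<close>, so the
      choices on \<open>A\<close> agree there with \<open>x'\<close>, whose symmetry matches them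
      with the choice at \<open>v\<close>.\<close>
    moreover have nbr: "h v \<in> y a \<longleftrightarrow> h a \<in> x' `` {h v}" if "a \<in> A" for a
      using y(3) hv(1) that x'(1) by (auto dest: symD)
    have "\<forall>a \<in> insert v A. \<forall>b \<in> insert v A. (a, b) \<in> E' \<longrightarrow> (h b \<in> ?y a \<longleftrightarrow> h a \<in> ?y b)"
      using y(2) nbr by auto
    moreover have "\<forall>a \<in> insert v A. \<forall>w. (h a, w) \<notin> D \<times> D \<longrightarrow> (w \<in> ?y a \<longleftrightarrow> (h a, w) \<in> x)"
    proof (intro ballI allI impI)
      fix a w assume a: "a \<in> insert v A" and aw: "(h a, w) \<notin> D \<times> D"
      have "(h a, w) \<in> x' \<longleftrightarrow> (h a, w) \<in> x" using x'(3) aw by blast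
      moreover have "w \<in> ?y a \<longleftrightarrow> (h a, w) \<in> x'" using a aw y(3) D'(1) by auto
      ultimately show "w \<in> ?y a \<longleftrightarrow> (h a, w) \<in> x" by blast
    qed
    ultimately show ?thesis by (intro exI[of _ ?y] conjI)
  qed
qed

section \<open>CFI graphs\<close>

text \<open>A set \<open>S\<close> of neighbours of \<open>v\<close> stands for a set of edges at \<open>v\<close>; \<open>U\<close> is the set of twisted
  vertices.\<close>

definition cfi :: "'a pair_pre_digraph \<Rightarrow> 'a set \<Rightarrow> ('a \<times> 'a set) pair_pre_digraph" where
  "cfi F U = (let V = {(v, S). v \<in> pverts F \<and> S \<subseteq> parcs F `` {v} \<and> (odd (card S) \<longleftrightarrow> v \<in> U)} in
    \<lparr>pverts = V, parcs = {((v, S), (w, T)). (v, S) \<in> V \<and> (w, T) \<in> V \<and> (v, w) \<in> parcs F \<and> (w \<in> S \<longleftrightarrow> v \<in> T)}\<rparr>)"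

lemma in_cfi [simp]:
  "(v, S) \<in> pverts (cfi F U) \<longleftrightarrow> v \<in> pverts F \<and> S \<subseteq> parcs F `` {v} \<and> (odd (card S) \<longleftrightarrow> v \<in> U)"
  "((v, S), (w, T)) \<in> parcs (cfi F U) \<longleftrightarrow> (v, S) \<in> pverts (cfi F U) \<and> (w, T) \<in> pverts (cfi F U) \<and>
    (v, w) \<in> parcs F \<and> (w \<in> S \<longleftrightarrow> v \<in> T)"
  by (simp_all add: cfi_def)

lemma pair_graphI:
  assumes "finite (pverts G)" "parcs G \<subseteq> pverts G \<times> pverts G" "sym (parcs G)" "irrefl (parcs G)"
  shows "pair_graph G"
proof
  show "finite (parcs G)" using assms(1,2) finite_subset by blast
  show "symmetric (with_proj G)" using assms(3) by (simp add: symmetric_def)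
qed (use assms in \<open>auto simp: irrefl_def\<close>)

lemma pair_graphD:
  assumes "pair_graph G"
  shows "finite (pverts G)" "finite (parcs G)" "parcs G \<subseteq> pverts G \<times> pverts G"
    "sym (parcs G)" "irrefl (parcs G)"
proof -
  interpret pair_graph G by fact
  show "finite (pverts G)" "finite (parcs G)" "parcs G \<subseteq> pverts G \<times> pverts G"
    using pair_finite_verts pair_finite_arcs wellformed' by auto
  show "sym (parcs G)" using pair_sym_arcs by (simp add: symmetric_def)
  show "irrefl (parcs G)" using pair_no_loops by (fastforce simp: irrefl_def)
qed

lemma pair_graph_cfi:
  assumes "pair_graph F"
  shows "pair_graph (cfi F U)"
proof (rule pair_graphI)
  note F = pair_graphD[OF assms]
  have "pverts (cfi F U) \<subseteq> pverts F \<times> Pow (pverts F)" using F(3) by fastforce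
  then show "finite (pverts (cfi F U))" by (rule finite_subset) (use F(1) in simp)
  show "parcs (cfi F U) \<subseteq> pverts (cfi F U) \<times> pverts (cfi F U)" by auto
  show "sym (parcs (cfi F U))" using F(4) by (auto simp: sym_def)
  show "irrefl (parcs (cfi F U))" using F(5) by (auto simp: irrefl_def)
qed

text \<open>A map \<open>a \<mapsto> (h a, y a)\<close> is a homomorphism into \<open>cfi F U\<close> iff \<open>h\<close> is one into \<open>F\<close> and \<open>y\<close> solves
  this system of linear equations over the two-element field.\<close>

definition cfi_lift :: "'b pair_pre_digraph \<Rightarrow> 'a pair_pre_digraph \<Rightarrow> 'a set \<Rightarrow> ('b \<Rightarrow> 'a) \<Rightarrow> ('b \<Rightarrow> 'a set) \<Rightarrow> bool"
  where "cfi_lift T F U h y \<longleftrightarrow>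
    (\<forall>a \<in> pverts T. y a \<subseteq> parcs F `` {h a} \<and> (odd (card (y a)) \<longleftrightarrow> h a \<in> U)) \<and>
    (\<forall>(a, b) \<in> parcs T. h b \<in> y a \<longleftrightarrow> h a \<in> y b)"

section \<open>Homomorphisms into CFI graphs as solutions of linear systems\<close>

text \<open>Linearity: symmetric difference is addition over the two-element field, and
  \<open>U\<close> and \<open>W\<close> are the right-hand sides of the parity equations.\<close>

lemma cfi_lift_sym_diff:
  assumes "finite (parcs F)" "cfi_lift T F U h y" "cfi_lift T F W h z"
  shows "cfi_lift T F (sym_diff U W) h (\<lambda>a. sym_diff (y a) (z a))"
proof -
  have fin: "finite (y a)" "finite (z a)" if "a \<in> pverts T" for a
    using assms that finite_Image[OF assms(1)] finite_subset unfolding cfi_lift_def by metis+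
  have "odd (card (sym_diff (y a) (z a))) \<longleftrightarrow> h a \<in> sym_diff U W" if "a \<in> pverts T" for a
    using odd_card_sym_diff[OF fin[OF that]] assms(2,3) that unfolding cfi_lift_def by blast
  moreover have "sym_diff (y a) (z a) \<subseteq> parcs F `` {h a}" if "a \<in> pverts T" for a
    using assms(2,3) that unfolding cfi_lift_def by blast
  moreover have "h b \<in> sym_diff (y a) (z a) \<longleftrightarrow> h a \<in> sym_diff (y b) (z b)" if "(a, b) \<in> parcs T" for a b
    using assms(2,3) that unfolding cfi_lift_def by blast
  ultimately show ?thesis unfolding cfi_lift_def by blast
qed

text \<open>The restriction makes the projection extensional, as membership in \<open>homs\<close>
  requires.\<close>

abbreviation cfi_proj :: "'b pair_pre_digraph \<Rightarrow> ('b \<Rightarrow> 'a \<times> 'a set) \<Rightarrow> 'b \<Rightarrow> 'a" where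
  "cfi_proj T f \<equiv> restrict (fst \<circ> f) (pverts T)"

lemma cfi_lift_if_homs:
  assumes "pair_graph T" "f \<in> homs T (cfi F U)"
  shows "cfi_proj T f \<in> homs T F" "cfi_lift T F U (cfi_proj T f) (snd \<circ> f)"
proof -
  note T = pair_graphD(3)[OF assms(1)]
  have v: "(fst (f a), snd (f a)) \<in> pverts (cfi F U)" if "a \<in> pverts T" for a
    using assms(2) that unfolding homs_def by auto
  have e: "((fst (f a), snd (f a)), (fst (f b), snd (f b))) \<in> parcs (cfi F U)" if "(a, b) \<in> parcs T" for a b
    using assms(2) that unfolding homs_def by auto
  show "cfi_proj T f \<in> homs T F" using v e T unfolding homs_def in_cfi by auto
  show "cfi_lift T F U (cfi_proj T f) (snd \<circ> f)" using v e T unfolding cfi_lift_def in_cfi by auto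
qed

lemma homs_if_cfi_lift:
  assumes "pair_graph T" "h \<in> homs T F" "cfi_lift T F U h y"
  shows "(\<lambda>a \<in> pverts T. (h a, y a)) \<in> homs T (cfi F U)"
proof -
  note T = pair_graphD(3)[OF assms(1)]
  have h: "h a \<in> pverts F" if "a \<in> pverts T" for a using assms(2) that unfolding homs_def by auto
  have "(h a, y a) \<in> pverts (cfi F U)" if "a \<in> pverts T" for a
    using h[OF that] assms(3) that unfolding cfi_lift_def by simp
  moreover have "((h a, y a), (h b, y b)) \<in> parcs (cfi F U)" if "(a, b) \<in> parcs T" for a b
    using calculation[of a] calculation[of b] that assms(2,3) T unfolding cfi_lift_def homs_def by auto
  ultimately show ?thesis using T unfolding homs_def by auto
qed

lemma finite_homs:
  assumes "finite (pverts F)" "finite (pverts G)"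
  shows "finite (homs F G)"
  using finite_PiE[of "pverts F" "\<lambda>_. pverts G"] assms unfolding homs_def by simp

text \<open>Over each fixed projection \<open>h\<close>, adding one particular solution for
  \<open>W\<close> translates the solutions for \<open>U\<close> injectively into those for the sum
  of the right-hand sides.\<close>

lemma inj_homs_cfi:
  assumes T: "pair_graph T" and F: "pair_graph F"
    and lift: "\<And>f. f \<in> homs T (cfi F U) \<Longrightarrow> \<exists>z. cfi_lift T F W (cfi_proj T f) z"
  shows "\<exists>g. inj_on g (homs T (cfi F U)) \<and> g ` homs T (cfi F U) \<subseteq> homs T (cfi F (sym_diff U W)) \<and>
    (\<forall>f \<in> homs T (cfi F U). cfi_proj T (g f) = cfi_proj T f)"
proof -
  \<comment> \<open>The chosen solution depends on \<open>h\<close> alone, so homomorphisms with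
    equal projection are shifted by the same amount; injectivity rests on this.\<close>
  define z where "z h = (SOME z. cfi_lift T F W h z)" for h
  define g where "g f = (\<lambda>a \<in> pverts T. (cfi_proj T f a, sym_diff (snd (f a)) (z (cfi_proj T f) a)))" for f
  have z: "cfi_lift T F W (cfi_proj T f) (z (cfi_proj T f))" if "f \<in> homs T (cfi F U)" for f
    unfolding z_def using lift[OF that] by (rule someI_ex)
  have "g f \<in> homs T (cfi F (sym_diff U W))" if f: "f \<in> homs T (cfi F U)" for f
    using homs_if_cfi_lift[OF T cfi_lift_if_homs(1)[OF T f]
        cfi_lift_sym_diff[OF pair_graphD(2)[OF F] cfi_lift_if_homs(2)[OF T f] z[OF f]]]
    unfolding g_def o_def .
  moreover have proj: "cfi_proj T (g f) = cfi_proj T f" for f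
    unfolding g_def by (rule ext) simp
  moreover have "inj_on g (homs T (cfi F U))"
  proof (rule inj_onI)
    fix f f' assume f: "f \<in> homs T (cfi F U)" "f' \<in> homs T (cfi F U)" and eq: "g f = g f'"
    have p: "cfi_proj T f = cfi_proj T f'" using proj eq by metis
    show "f = f'"
    proof (rule PiE_ext)
      show "f \<in> pverts T \<rightarrow>\<^sub>E pverts (cfi F U)" "f' \<in> pverts T \<rightarrow>\<^sub>E pverts (cfi F U)"
        using f unfolding homs_def by auto
      fix a assume a: "a \<in> pverts T"
      have "fst (f a) = fst (f' a)" using fun_cong[OF p, of a] a by simp
      moreover have "sym_diff (snd (f a)) (z (cfi_proj T f) a) = sym_diff (snd (f' a)) (z (cfi_proj T f) a)"
        using fun_cong[OF eq, of a] a unfolding g_def p by simp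
      then have "snd (f a) = snd (f' a)" by blast
      ultimately show "f a = f' a" by (rule prod_eqI)
    qed
  qed
  ultimately show ?thesis by blast
qed

text \<open>Applied with \<open>W = {u}\<close> to \<open>U = {}\<close> and to
  \<open>U = {u}\<close>: adding \<open>W\<close> exchanges the two, so both inequalities between
  the counts follow.\<close>

lemma hom_cfi_le:
  assumes "pair_graph T" "pair_graph F"
    and "\<And>f. f \<in> homs T (cfi F U) \<Longrightarrow> \<exists>z. cfi_lift T F W (cfi_proj T f) z"
  shows "hom T (cfi F U) \<le> hom T (cfi F (sym_diff U W))"
proof -
  obtain g where "inj_on g (homs T (cfi F U))" "g ` homs T (cfi F U) \<subseteq> homs T (cfi F (sym_diff U W))"
    using inj_homs_cfi[OF assms] by blast
  then show ?thesis unfolding hom_def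
    using card_inj_on_le finite_homs pair_graphD(1) pair_graph_cfi assms(1,2) by metis
qed

section \<open>The identity has no lift to the twisted graph\<close>

text \<open>The ascending arcs and their reversals split \<open>R\<close> into halves of equal size;
  the linear order only picks an orientation.\<close>

lemma even_card_sym_irrefl:
  fixes R :: "('a :: linorder) rel"
  assumes "finite R" "sym R" "irrefl R"
  shows "even (card R)"
proof -
  define A where "A = {(v, w) \<in> R. v < w}"
  have fin: "finite A" using assms(1) unfolding A_def by (rule rev_finite_subset) auto
  have "R = A \<union> A\<inverse>" using assms(2,3) unfolding A_def by (auto simp: sym_def irrefl_def) (metis linorder_neqE)
  moreover have "card (A \<union> A\<inverse>) = card A + card (A\<inverse>)"
    using fin unfolding A_def by (intro card_Un_disjoint) auto
  ultimately show ?thesis by (simp add: card_inverse)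
qed

text \<open>Double counting the arcs chosen within the component \<open>C\<close>.\<close>

lemma no_cfi_lift_id:
  fixes F :: "('a :: linorder) pair_pre_digraph"
  assumes F: "pair_graph F" and C: "C \<subseteq> pverts F" "parcs F \<inter> C \<times> (pverts F - C) = {}" and "u \<in> C"
  shows "\<not> cfi_lift F F {u} (restrict id (pverts F)) y"
proof
  note F' = pair_graphD[OF F]
  assume "cfi_lift F F {u} (restrict id (pverts F)) y"
  then have y: "\<And>a. a \<in> pverts F \<Longrightarrow> y a \<subseteq> parcs F `` {a} \<and> (odd (card (y a)) \<longleftrightarrow> a = u)"
    "\<And>a b. (a, b) \<in> parcs F \<Longrightarrow> b \<in> y a \<longleftrightarrow> a \<in> y b"
    using F'(3) unfolding cfi_lift_def by fastforce+
  define R where "R = (SIGMA a:C. y a)"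
  have fin: "finite C" "\<forall>a \<in> C. finite (y a)"
    using C(1) F'(1) y(1) finite_Image[OF F'(2)] finite_subset by (metis, metis subsetD)
  have R: "(a, b) \<in> R \<longleftrightarrow> a \<in> C \<and> b \<in> C \<and> (a, b) \<in> parcs F \<and> b \<in> y a" for a b
    using y(1)[of a] C F'(3) unfolding R_def by blast
  have "even (card R)"
  proof (rule even_card_sym_irrefl)
    show "finite R" using fin unfolding R_def by blast
    show "sym R" using F'(4) y(2) unfolding sym_def R by blast
    show "irrefl R" using F'(5) unfolding irrefl_def R by blast
  qed
  \<comment> \<open>Grouped by first component, only \<open>u\<close> contributes an odd number, so
    \<open>R\<close> would have odd size.\<close>
  moreover have "card R = card (y u) + (\<Sum>a \<in> C - {u}. card (y a))"
    unfolding R_def using fin \<open>u \<in> C\<close> by (simp add: sum.remove)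
  moreover have "even (\<Sum>a \<in> C - {u}. card (y a))" using y(1) C(1) by (intro dvd_sum) auto
  moreover have "odd (card (y u))" using y(1) C(1) \<open>u \<in> C\<close> by auto
  ultimately show False by simp
qed

section \<open>Transfer to graphs on natural numbers\<close>

text \<open>The closure quantifies over graphs with vertices in \<open>nat\<close>, whereas CFI
  graphs live on pairs. Relabelling the target along an injection preserves all homomorphism
  counts.\<close>

lemma ex_nat_copy:
  assumes "pair_graph G"
  obtains G' :: "nat pair_pre_digraph"
    where "pair_graph G'" "\<forall>F :: 'b pair_pre_digraph. pair_graph F \<longrightarrow> hom F G' = hom F G"
proof -
  note G = pair_graphD[OF assms]
  obtain i :: "'a \<Rightarrow> nat" where i: "inj_on i (pverts G)" using finite_imp_inj_to_nat_seg[OF G(1)] by blast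
  define G' where "G' = \<lparr>pverts = i ` pverts G, parcs = map_prod i i ` parcs G\<rparr>"
  have arcs: "(i a, i b) \<in> parcs G' \<longleftrightarrow> (a, b) \<in> parcs G" if "a \<in> pverts G" "b \<in> pverts G" for a b
  proof
    assume "(i a, i b) \<in> parcs G'"
    then obtain c d where cd: "(c, d) \<in> parcs G" "i a = i c" "i b = i d" unfolding G'_def by auto
    then have "a = c" "b = d" using that G(3) inj_onD[OF i] by blast+
    then show "(a, b) \<in> parcs G" using cd(1) by simp
  qed (force simp: G'_def)
  have "pair_graph G'"
  proof (rule pair_graphI)
    show "finite (pverts G')" "parcs G' \<subseteq> pverts G' \<times> pverts G'" using G(1,3) unfolding G'_def by auto
    show "sym (parcs G')" using G(4) unfolding G'_def sym_def by auto
    show "irrefl (parcs G')" using G(3,5) i unfolding G'_def irrefl_def inj_on_def by auto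
  qed
  moreover have "hom F G' = hom F G" if F: "pair_graph F" for F :: "'b pair_pre_digraph"
  proof -
    note F3 = pair_graphD(3)[OF F]
    let ?\<phi> = "\<lambda>f. restrict (i \<circ> f) (pverts F)" and ?\<psi> = "\<lambda>f. restrict (inv_into (pverts G) i \<circ> f) (pverts F)"
    have "bij_betw ?\<phi> (homs F G) (homs F G')"
    proof (rule bij_betw_byWitness[where f' = ?\<psi>])
      show "\<forall>f \<in> homs F G. ?\<psi> (?\<phi> f) = f"
        using i by (auto simp: homs_def fun_eq_iff PiE_def extensional_def Pi_def)
      show "\<forall>f \<in> homs F G'. ?\<phi> (?\<psi> f) = f"
        by (auto simp: homs_def fun_eq_iff PiE_def extensional_def Pi_def G'_def f_inv_into_f)
      show "?\<phi> ` homs F G \<subseteq> homs F G'"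
      proof clarify
        fix f assume f: "f \<in> homs F G"
        then have v: "f a \<in> pverts G" if "a \<in> pverts F" for a using that unfolding homs_def by auto
        have "(?\<phi> f a, ?\<phi> f b) \<in> parcs G'" if "(a, b) \<in> parcs F" for a b
        proof -
          have "a \<in> pverts F" "b \<in> pverts F" "(f a, f b) \<in> parcs G" using that f F3 unfolding homs_def by auto
          then show ?thesis using arcs v by simp
        qed
        moreover have "?\<phi> f \<in> pverts F \<rightarrow>\<^sub>E pverts G'" using v unfolding G'_def by auto
        ultimately show "?\<phi> f \<in> homs F G'" unfolding homs_def by blast
      qed
      show "?\<psi> ` homs F G' \<subseteq> homs F G"
      proof clarify
        fix f assume f: "f \<in> homs F G'"
        then have v: "f a \<in> i ` pverts G" if "a \<in> pverts F" for a using that unfolding homs_def G'_def by auto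
        have w: "inv_into (pverts G) i (f a) \<in> pverts G" "i (inv_into (pverts G) i (f a)) = f a"
          if "a \<in> pverts F" for a
          using v[OF that] by (simp_all add: inv_into_into f_inv_into_f)
        have "(?\<psi> f a, ?\<psi> f b) \<in> parcs G" if "(a, b) \<in> parcs F" for a b
        proof -
          have "a \<in> pverts F" "b \<in> pverts F" "(f a, f b) \<in> parcs G'" using that f F3 unfolding homs_def by auto
          then show ?thesis
            using arcs[OF w(1) w(1), of a b] w(2)[of a] w(2)[of b] by simp
        qed
        moreover have "?\<psi> f \<in> pverts F \<rightarrow>\<^sub>E pverts G" using w by auto
        ultimately show "?\<psi> f \<in> homs F G" unfolding homs_def by blast
      qed
    qed
    then show ?thesis unfolding hom_def by (simp add: bij_betw_same_card)
  qed
  ultimately show thesis using that by blast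
qed

theorem theorem3:
  fixes q :: nat
  assumes "q \<ge> 1"
  shows "hom_dist_closed (TD q)"
proof -
  have "F \<in> TD q" if F: "F \<in> hom_dist_closure (TD q)" for F
  proof (rule ccontr)
    assume "F \<notin> TD q"
    have pF: "pair_graph F" using F unfolding hom_dist_closure_def by blast
    note F' = pair_graphD[OF pF]
    have deep: "\<not> elim_depth (parcs F) q (pverts F)"
      using \<open>F \<notin> TD q\<close> pF treedepth_le_iff_elim_depth[OF pF] unfolding TD_def by blast
    obtain C where C: "C \<subseteq> pverts F" "\<not> elim_depth (parcs F) q C"
      "\<forall>a \<in> C. \<forall>b \<in> C. (a, b) \<in> (parcs F \<inter> C \<times> C)\<^sup>*" "parcs F \<inter> C \<times> (pverts F - C) = {}"
      using ex_component_not_elim_depth[OF F'(1,4) deep] by (elim exE conjE)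
    then obtain u where u: "u \<in> C" by (metis elim_depth.empty ex_in_conv)
    have lift: "\<exists>z. cfi_lift T F {u} h z" if T: "T \<in> TD q" for T :: "nat pair_pre_digraph" and h
    proof -
      have pT: "pair_graph T" and depth: "elim_depth (parcs T) q (pverts T)"
        using T treedepth_le_iff_elim_depth unfolding TD_def by auto
      have "finite C" using C(1) F'(1) finite_subset by blast
      \<comment> \<open>The game starts with territory \<open>C\<close> and no edge chosen: all
        parities are even, which for \<open>U = {u}\<close> is wrong exactly at
        \<open>u\<close>.\<close>
      from ex_local_parities[OF F'(2,4,5) pair_graphD(4)[OF pT] depth \<open>finite C\<close> C(2,3) u, of "{}" "{u}" h]
      obtain y where y: "\<forall>a \<in> pverts T. y a \<subseteq> parcs F `` {h a} \<and> (odd (card (y a)) \<longleftrightarrow> h a \<in> {u})"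
        "\<forall>a \<in> pverts T. \<forall>b \<in> pverts T. (a, b) \<in> parcs T \<longrightarrow> (h b \<in> y a \<longleftrightarrow> h a \<in> y b)"
        by (auto simp: sym_def)
      then have "cfi_lift T F {u} h y" using pair_graphD(3)[OF pT] unfolding cfi_lift_def by blast
      then show ?thesis by blast
    qed
    have eq: "hom T (cfi F {}) = hom T (cfi F {u})" if "T \<in> TD q" for T
    proof -
      have "pair_graph T" using that unfolding TD_def by blast
      from hom_cfi_le[OF this pF lift[OF that], of "{}"] hom_cfi_le[OF this pF lift[OF that], of "{u}"]
      show ?thesis by simp
    qed
    have less: "hom F (cfi F {u}) < hom F (cfi F {})"
    proof -
      \<comment> \<open>A homomorphism into the twisted graph is itself a twisted solution over its
        projection, so translation embeds the twisted count into the untwisted one.\<close>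
      have lifts: "\<exists>z. cfi_lift F F {u} (cfi_proj F f) z" if "f \<in> homs F (cfi F {u})" for f
        using cfi_lift_if_homs(2)[OF pF that] by blast
      obtain g where g: "inj_on g (homs F (cfi F {u}))"
        "g ` homs F (cfi F {u}) \<subseteq> homs F (cfi F {})"
        "\<forall>f \<in> homs F (cfi F {u}). cfi_proj F (g f) = cfi_proj F f"
        using inj_homs_cfi[OF pF pF lifts, of "{u}"] by auto
      \<comment> \<open>The zero solution over the identity. As \<open>g\<close> preserves
        projections, a preimage of it would lift the identity to the twisted graph; so
        \<open>g\<close> is not onto and the inequality is strict.\<close>
      define f\<^sub>0 where "f\<^sub>0 = (\<lambda>a \<in> pverts F. (a, {} :: nat set))"
      have f0: "f\<^sub>0 \<in> homs F (cfi F {})" using F'(3) unfolding f\<^sub>0_def homs_def by auto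
      have "f\<^sub>0 \<notin> g ` homs F (cfi F {u})"
      proof
        assume "f\<^sub>0 \<in> g ` homs F (cfi F {u})"
        then obtain f where f: "f \<in> homs F (cfi F {u})" "f\<^sub>0 = g f" by blast
        have "cfi_proj F f\<^sub>0 = restrict id (pverts F)" unfolding f\<^sub>0_def by (rule ext) simp
        then show False
          using cfi_lift_if_homs(2)[OF pF f(1)] g(3) f no_cfi_lift_id[OF pF C(1,4) u] by auto
      qed
      then have "g ` homs F (cfi F {u}) \<subset> homs F (cfi F {})" using g(2) f0 by blast
      moreover have "finite (homs F (cfi F {}))"
        using finite_homs F'(1) pair_graphD(1)[OF pair_graph_cfi[OF pF]] by blast
      ultimately have "card (g ` homs F (cfi F {u})) < card (homs F (cfi F {}))"
        by (intro psubset_card_mono)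
      then show ?thesis unfolding hom_def using card_image[OF g(1)] by simp
    qed
    obtain G :: "nat pair_pre_digraph" where G: "pair_graph G"
      "\<forall>T :: nat pair_pre_digraph. pair_graph T \<longrightarrow> hom T G = hom T (cfi F {})"
      by (rule ex_nat_copy[OF pair_graph_cfi[OF pF]])
    obtain H :: "nat pair_pre_digraph" where H: "pair_graph H"
      "\<forall>T :: nat pair_pre_digraph. pair_graph T \<longrightarrow> hom T H = hom T (cfi F {u})"
      by (rule ex_nat_copy[OF pair_graph_cfi[OF pF]])
    have "hom_indist (TD q) G H" unfolding hom_indist_def using G(2) H(2) eq by (simp add: TD_def)
    then have "hom F G = hom F H" using F G(1) H(1) by (simp add: hom_dist_closure_def)
    then show False using G(2) H(2) pF less by simp
  qed
  moreover have "TD q \<subseteq> hom_dist_closure (TD q)"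
    unfolding hom_dist_closure_def hom_indist_def by (auto simp: TD_def)
  ultimately show ?thesis unfolding hom_dist_closed_def by blast
qed

end
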